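(* Let $\{K_n:n\ge1\}$ be a sequence of nonempty compact subsets of $\mathcal X$ and let $p\in[1,\infty)$. Assume that the collection $\{X^n_s : s\in S_n,\ n\ge 1\}$ of $\mathcal X$-valued random elements is $(\nu_n)$-$\mathrm{CUI}(p)$ with respect to $\{K_n\}$. Assume that for any $n\ge1$ there exists $D_n\in\mathcal S_n\otimes\mathcal S_n$ such that: (a) $\displaystyle\lim_{n\to\infty}N(K_n,\varepsilon)^{1-(\frac1p\wedge\frac12)}\,\|K_n\|\,\big((\nu_n\otimes\nu_n)(D_n)\big)^{\frac1p\wedge\frac12}=0$ for all $\varepsilon>0$; (b) $X^n_s$ and $X^n_t$ are diagonally negatively dependent for $(\nu_n\otimes\nu_n)$-a.e. $(s,t)\in(S_n\times S_n)\setminus D_n$. Then $$\lim_{n\to\infty}\mathbb E\left\|\int_{S_n}\left(X^n_s-\mathbb E X^n_s\right)\nu_n(\mathrm ds)\right\|^p=0,$$ and in particular, $\int_{S_n}(X^n_s-\mathbb E X^n_s)\,\nu_n(\mathrm ds)\to0$ in probability as $n\to\infty$.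
   Context: Standing setting: $(\mathcal X,\|\cdot\|)$ is a separable Banach space with Borel $\sigma$-algebra $\mathcal B(\mathcal X)$; $(\Omega,\mathcal F,\mathbb P)$ is a complete probability space; an $\mathcal X$-valued random element is an $\mathcal F/\mathcal B(\mathcal X)$-measurable map $\Omega\to\mathcal X$. $\{(S_n,\mathcal S_n,\nu_n):n\ge1\}$ is a family of finite measure spaces with $\sup_{n\ge1}\nu_n(S_n)=:C_\nu\in(0,\infty)$. Integrals and expectations of $\mathcal X$-valued functions are Bochner integrals. $a\wedge b:=\min\{a,b\}$. For a nonempty compact $K\subseteq\mathcal X$ and $\varepsilon>0$: $\|K\|:=\max\{\|x\|:x\in K\}$, and $N(K,\varepsilon)$ is the minimal $n\ge1$ such that $K$ is covered by $n$ open balls of radius $\varepsilon$ with centers in $K$. Definition ($(\nu_n)$-$\mathrm{CUI}(p)$ w.r.t. $\{K_n\}$), for $p\in(0,\infty)$ and compact sets $K_n\subset\mathcal X$: a collection $\{X^n_s:s\in S_n,n\ge1\}$ of $\mathcal X$-valued random elements is $(\nu_n)$-$\mathrm{CUI}(p)$ w.r.t. $\{K_n\}$ if (i) the map $(\omega,s)\mapsto X^n_s(\omega)$ is $\mathcal F\otimes\mathcal S_n/\mathcal B(\mathcal X)$-measurable for every $n\ge1$; and (ii) $\lim_{n\to\infty}\mathbb E\int_{S_n}\|X^n_s\|^p\,\mathbf 1_{\{X^n_s\notin K_n\}}\,\nu_n(\mathrm ds)=0$. Definition: two $\mathcal X$-valued random elements $X,Y$ are diagonally negatively dependent if $\mathbb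 P(X\in A,\,Y\in A)\le\mathbb P(X\in A)\,\mathbb P(Y\in A)$ for all $A\in\mathcal B(\mathcal X)$. Under the CUI condition with $p\ge1$, there is $n_0$ such that for all $n\ge n_0$: $\mathbb E\|X^n_s\|<\infty$ for $\nu_n$-a.e. $s$ (with $\mathbb E X^n_s$ taken to be $0$ on the exceptional null set) and the Bochner integral $\int_{S_n}(X^n_s-\mathbb E X^n_s)\,\nu_n(\mathrm ds)$ exists almost surely; the limits are understood along $n\ge n_0$. *)

theory Defs
  imports "HOL-Probability.Probability"
begin

definition set_norm :: "'x::real_normed_vector set \<Rightarrow> real" where
  "set_norm K = (SUP x\<in>K. norm x)"

text \<open>For nonempty compact sets the supremum is a maximum.\<close>

lemma set_norm_attained:
  fixes K :: "'x::real_normed_vector set"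
  assumes "compact K" "K \<noteq> {}"
  shows "\<exists>x\<in>K. norm x = set_norm K \<and> (\<forall>y\<in>K. norm y \<le> set_norm K)"
proof -
  obtain x where x: "x \<in> K" "\<And>y. y \<in> K \<Longrightarrow> norm y \<le> norm x"
    using continuous_attains_sup[OF assms, of norm] continuous_on_norm_id by auto
  have "set_norm K = norm x"
    unfolding set_norm_def using x by (intro cSup_eq_maximum) auto
  with x show ?thesis by auto
qed

definition covering_number :: "'x::metric_space set \<Rightarrow> real \<Rightarrow> nat" where
  "covering_number K \<epsilon> =
    (LEAST n. n \<ge> 1 \<and> (\<exists>C. C \<subseteq> K \<and> finite C \<and> card C = n \<and> K \<subseteq> (\<Union>c\<in>C. ball c \<epsilon>)))"

text \<open>The family of measure spaces is \<open>\<nu> n\<close> for \<open>n \<ge> 1\<close>; index \<open>0\<close> carries no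
  meaning. The expectation in the limit may be infinite for finitely many \<open>n\<close>, so it is
  taken in the extended nonnegative reals.\<close>

definition CUI ::
  "'w measure \<Rightarrow> (nat \<Rightarrow> 's measure) \<Rightarrow> real \<Rightarrow>
    (nat \<Rightarrow> 'x::{banach, second_countable_topology} set) \<Rightarrow> (nat \<Rightarrow> 's \<Rightarrow> 'w \<Rightarrow> 'x) \<Rightarrow> bool" where
  "CUI M \<nu> p K X \<longleftrightarrow>
    (\<forall>n\<ge>1. \<forall>s\<in>space (\<nu> n). X n s \<in> borel_measurable M) \<and>
    (\<forall>n\<ge>1. (\<lambda>(\<omega>, s). X n s \<omega>) \<in> borel_measurable (M \<Otimes>\<^sub>M \<nu> n)) \<and>
    (\<lambda>n. \<integral>\<^sup>+\<omega>. (\<integral>\<^sup>+s. ennreal (norm (X n s \<omega>) powr p) * indicator (- K n) (X n s \<omega>) \<partial>\<nu> n) \<partial>M)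
      \<longlonglongrightarrow> 0"

definition diag_neg_dependent ::
  "'w measure \<Rightarrow> ('w \<Rightarrow> 'x::topological_space) \<Rightarrow> ('w \<Rightarrow> 'x) \<Rightarrow> bool" where
  "diag_neg_dependent M X Y \<longleftrightarrow>
    (\<forall>A\<in>sets borel. \<P>(\<omega> in M. X \<omega> \<in> A \<and> Y \<omega> \<in> A) \<le> \<P>(\<omega> in M. X \<omega> \<in> A) * \<P>(\<omega> in M. Y \<omega> \<in> A))"

text \<open>The Bochner integral of a non-integrable function is \<open>0\<close>; this provides the
  convention that the expectation of \<open>X s\<close> is \<open>0\<close> for the exceptional \<open>s\<close>.\<close>

definition centered_integral ::
  "'w measure \<Rightarrow> 's measure \<Rightarrow> ('s \<Rightarrow> 'w \<Rightarrow> 'x::{banach, second_countable_topology}) \<Rightarrow> 'w \<Rightarrow> 'x" where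
  "centered_integral M N X \<omega> = (\<integral>s. (X s \<omega> - (\<integral>\<omega>'. X s \<omega>' \<partial>M)) \<partial>N)"

end

theory Submission
  imports Defs
begin

text \<open>
  Truncate \<open>X\<^sub>n\<close> to \<open>K\<^sub>n\<close> and round the truncated field to the centers \<open>c\<^sub>i\<close> of a minimal \<open>\<epsilon>\<close>-cover of
  \<open>K\<^sub>n\<close>, whose disjointed balls are the cells \<open>A\<^sub>i\<close>. Jensen's inequality makes the truncation error
  vanish in \<open>L\<^sup>p\<close> and bounds the rounding error by a multiple of \<open>\<epsilon>\<close>. The rounded field contributes
  \<open>\<Sum>\<^sub>i \<xi>\<^sub>i c\<^sub>i\<close>, where \<open>\<xi>\<^sub>i\<close> is the centered \<open>\<nu>\<^sub>n\<close>-mass of the indices \<open>s\<close> with \<open>X\<^sub>s \<in> A\<^sub>i\<close>. By diagonal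
  negative dependence the variance of \<open>\<xi>\<^sub>i\<close> is at most the integral over \<open>D\<^sub>n\<close> of
  \<open>P(X\<^sub>s \<in> A\<^sub>i, X\<^sub>t \<in> A\<^sub>i)\<close>, and since the cells are disjoint these variances sum to at most
  \<open>(\<nu>\<^sub>n \<otimes> \<nu>\<^sub>n)(D\<^sub>n)\<close>. As \<open>\<bar>\<xi>\<^sub>i\<bar> \<le> C\<close>, this controls the moment of order \<open>q = max p 2\<close>, and \<open>1/q\<close> is exactly the
  exponent \<open>(1/p) \<and> (1/2)\<close> of hypothesis (a).
\<close>

section \<open>Convexity inequalities for powers\<close>

lemma powr_above_tangent:
  fixes x m p :: real
  assumes "0 \<le> x" "0 < m" "1 \<le> p"
  shows "m powr p + p * m powr (p - 1) * (x - m) \<le> x powr p"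
proof (cases "x = 0")
  case True
  have "m powr (p - 1) * m = m powr p"
    using assms by (simp add: powr_diff)
  moreover have "m powr p \<le> p * m powr p"
    using assms by simp
  ultimately show ?thesis
    using True by (simp add: algebra_simps)
next
  case False
  \<comment> \<open>The second-derivative test is run on the open half-line, where
    \<open>powr\<close> is smooth for every real exponent. The endpoint \<open>x = 0\<close> is
    therefore treated apart; there the tangent takes the value (1 - p) m^p, which is
    nonpositive.\<close>
  have conv: "convex_on {0<..} (\<lambda>x::real. x powr p)"
  proof (rule f''_ge0_imp_convex)
    show "((\<lambda>x. x powr p) has_real_derivative p * x powr (p - 1)) (at x)" if "x \<in> {0<..}" for x
      using that by (auto intro!: derivative_eq_intros)
    show "((\<lambda>x. p * x powr (p - 1)) has_real_derivative p * ((p - 1) * x powr (p - 1 - 1))) (at x)"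
      if "x \<in> {0<..}" for x
      using that by (auto intro!: derivative_eq_intros)
    show "0 \<le> p * ((p - 1) * x powr (p - 1 - 1))" for x
      using assms by simp
  qed simp
  have "p * m powr (p - 1) * (x - m) \<le> x powr p - m powr p"
  proof (rule convex_on_imp_above_tangent[OF conv])
    show "((\<lambda>x. x powr p) has_real_derivative p * m powr (p - 1)) (at m within {0<..})"
      using assms by (auto intro!: derivative_eq_intros)
    show "m \<in> interior {0<..}" "x \<in> {0<..}"
      using assms False by (auto simp: interior_open)
    show "connected {0::real<..}" by simp
  qed
  then show ?thesis by simp
qed

text \<open>The sum is at most twice the maximum. The constant is larger than the convexity constant
  2^(p-1), but constants are harmless in the limit and this bound also covers p < 1.\<close>

lemma powr_add_le:
  fixes a b p :: real
  assumes "0 \<le> a" "0 \<le> b" "0 \<le> p"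
  shows "(a + b) powr p \<le> 2 powr p * (a powr p + b powr p)"
proof -
  have "(a + b) powr p \<le> (2 * max a b) powr p"
    using assms by (intro powr_mono2) auto
  also have "\<dots> = 2 powr p * max a b powr p"
    using assms by (simp add: powr_mult)
  also have "\<dots> \<le> 2 powr p * (a powr p + b powr p)"
    by (intro mult_left_mono) (auto simp: max_def)
  finally show ?thesis .
qed

text \<open>Jensen's inequality for a measure that is not normalized, with any upper bound
  \<open>C\<close> of the mass. The extended form avoids integrability assumptions: if
  \<open>f\<close> is not integrable, its Bochner integral is 0 and the left side vanishes; if the
  power has infinite integral, the right side is infinite.\<close>

lemma (in finite_measure) integral_powr_le:
  fixes f :: "'a \<Rightarrow> real"
  assumes [measurable]: "f \<in> borel_measurable M"
    and nonneg: "\<And>x. x \<in> space M \<Longrightarrow> 0 \<le> f x"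
    and C: "measure M (space M) \<le> C" and p: "1 \<le> p"
  shows "ennreal ((\<integral>x. f x \<partial>M) powr p) \<le> ennreal (C powr (p - 1)) * (\<integral>\<^sup>+x. ennreal (f x powr p) \<partial>M)"
proof (cases "(\<integral>x. f x \<partial>M) = 0")
  case True
  then show ?thesis by simp
next
  case False
  define a where "a = (\<integral>x. f x \<partial>M)"
  define m where "m = measure M (space M)"
  have int: "integrable M f"
    using False not_integrable_integral_eq by blast
  have a: "0 < a"
    using False Bochner_Integration.integral_nonneg[of M f] nonneg unfolding a_def by (simp add: order.strict_iff_order)
  have m: "0 < m"
  proof (rule ccontr)
    assume "\<not> 0 < m"
    then have "emeasure M (space M) = 0"
      unfolding m_def by (metis emeasure_eq_measure ennreal_eq_0_iff not_less)
    then have "AE x in M. f x = 0"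
      by (intro AE_I[of _ _ "space M"]) auto
    then have "a = 0"
      unfolding a_def by (rule integral_eq_zero_AE)
    with a show False by simp
  qed
  have C0: "0 < C" using m C by (simp add: m_def)
  show ?thesis
  proof (cases "(\<integral>\<^sup>+x. ennreal (f x powr p) \<partial>M) = \<top>")
    case True
    then show ?thesis using C0 by (simp add: ennreal_mult_top)
  next
    case False
    have intp: "integrable M (\<lambda>x. f x powr p)"
      using False by (intro integrableI_nonneg) (auto simp: top.not_eq_extremum)
    \<comment> \<open>The mean of \<open>f\<close>. The tangent is taken at this point because its
      linear term then integrates to 0.\<close>
    define r where "r = a / m"
    have r: "0 < r" using a m by (simp add: r_def)
    have "m * r powr p = (\<integral>x. r powr p + p * r powr (p - 1) * (f x - r) \<partial>M)"
      using int m by (simp add: a_def[symmetric] m_def[symmetric] r_def)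
    also have "\<dots> \<le> (\<integral>x. f x powr p \<partial>M)"
      using int intp r p nonneg by (intro integral_mono powr_above_tangent) auto
    finally have *: "m * r powr p \<le> (\<integral>x. f x powr p \<partial>M)" .
    have "a powr p = (m * r) powr p"
      using m by (simp add: r_def)
    also have "\<dots> = m powr (p - 1) * (m * r powr p)"
      using m r by (simp add: powr_mult powr_diff)
    also have "\<dots> \<le> C powr (p - 1) * (\<integral>x. f x powr p \<partial>M)"
      using * m C p r by (intro mult_mono powr_mono2) (auto simp: m_def)
    finally show ?thesis
      using nn_integral_eq_integral[OF intp]
      by (simp add: a_def ennreal_leI flip: ennreal_mult')
  qed
qed

text \<open>This is \<open>integral_powr_le\<close> for the counting measure on \<open>I\<close>,
  whose mass is \<open>card I\<close>.\<close>

lemma sum_powr_le: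
  fixes f :: "'i \<Rightarrow> real"
  assumes fin: "finite I" and nonneg: "\<And>i. i \<in> I \<Longrightarrow> 0 \<le> f i" and p: "1 \<le> p"
  shows "(\<Sum>i\<in>I. f i) powr p \<le> real (card I) powr (p - 1) * (\<Sum>i\<in>I. f i powr p)"
proof -
  interpret finite_measure "count_space I"
    using fin by (rule finite_measure_count_space)
  have "ennreal ((\<Sum>i\<in>I. f i) powr p)
      \<le> ennreal (real (card I) powr (p - 1)) * (\<integral>\<^sup>+i. ennreal (f i powr p) \<partial>count_space I)"
    using integral_powr_le[of f "real (card I)" p] assms
    by (simp add: lebesgue_integral_count_space_finite measure_count_space)
  also have "\<dots> = ennreal (real (card I) powr (p - 1) * (\<Sum>i\<in>I. f i powr p))"
    using fin by (simp add: nn_integral_count_space_finite sum_ennreal ennreal_mult sum_nonneg)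
  finally show ?thesis
    by (subst (asm) ennreal_le_iff) (auto intro!: mult_nonneg_nonneg sum_nonneg)
qed

section \<open>Disjoint cells from a minimal cover, and limits in the extended reals\<close>

lemma covering_number_partition:
  fixes K :: "'x::metric_space set"
  assumes K: "compact K" "K \<noteq> {}" and \<epsilon>: "0 < \<epsilon>"
  obtains A :: "nat \<Rightarrow> 'x set" and c :: "nat \<Rightarrow> 'x"
  where "\<And>i. A i \<in> sets borel" "disjoint_family A" "(\<Union>i<covering_number K \<epsilon>. A i) = K"
    "\<And>i. i < covering_number K \<epsilon> \<Longrightarrow> c i \<in> K"
    "\<And>i x. i < covering_number K \<epsilon> \<Longrightarrow> x \<in> A i \<Longrightarrow> dist x (c i) \<le> \<epsilon>"
proof -
  let ?P = "\<lambda>n. n \<ge> 1 \<and> (\<exists>C. C \<subseteq> K \<and> finite C \<and> card C = n \<and> K \<subseteq> (\<Union>c\<in>C. ball c \<epsilon>))"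
  define n where "n = covering_number K \<epsilon>"
  \<comment> \<open>Compactness yields some admissible finite cover. Without one, the
    \<open>LEAST\<close> in \<open>covering_number\<close> could not be unfolded into an actual
    cover.\<close>
  have "K \<subseteq> (\<Union>c\<in>K. ball c \<epsilon>)"
    using \<epsilon> by auto
  then obtain C where "C \<subseteq> K" "finite C" "K \<subseteq> (\<Union>c\<in>C. ball c \<epsilon>)"
    using compactE_image[OF K(1), of K "\<lambda>c. ball c \<epsilon>"] by auto
  moreover from this K(2) have "1 \<le> card C"
    by (auto simp: Suc_le_eq card_gt_0_iff)
  ultimately have "?P (card C)"
    by blast
  then have "?P n"
    unfolding n_def covering_number_def by (rule LeastI)
  then obtain C where C: "C \<subseteq> K" "finite C" "card C = n" "K \<subseteq> (\<Union>c\<in>C. ball c \<epsilon>)"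
    by blast
  obtain c where c: "bij_betw c {..<n} C"
    using ex_bij_betw_nat_finite[OF C(2)] C(3) by (auto simp: atLeast0LessThan)
  \<comment> \<open>Padding with empty sets beyond \<open>n\<close> allows disjointing along all of
    the naturals. Intersecting the balls with \<open>K\<close> keeps every cell inside
    \<open>K\<close>, so the cells partition \<open>K\<close> exactly.\<close>
  define A where "A = disjointed (\<lambda>i. if i < n then K \<inter> ball (c i) \<epsilon> else {})"
  have A_sub: "A i \<subseteq> (if i < n then K \<inter> ball (c i) \<epsilon> else {})" for i
    unfolding A_def by (rule disjointed_subset)
  have "(\<Union>i. A i) = (\<Union>i<n. K \<inter> ball (c i) \<epsilon>)"
    unfolding A_def UN_disjointed_eq by auto
  also have "\<dots> = K"
    using C(4) unfolding bij_betw_imp_surj_on[OF c, symmetric] by blast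
  finally have UN: "(\<Union>i. A i) = K" .
  have "x \<in> A i \<Longrightarrow> i < n" for i x
    using A_sub[of i] by (auto split: if_splits)
  then have "(\<Union>i. A i) = (\<Union>i<n. A i)"
    by blast
  with UN have "(\<Union>i<n. A i) = K"
    by simp
  moreover have "A i \<in> sets borel" for i
  proof -
    have "range A \<subseteq> sets borel"
      unfolding A_def using K(1) by (intro sets.range_disjointed_sets) (auto simp: compact_imp_closed)
    then show ?thesis by auto
  qed
  moreover have "disjoint_family A"
    unfolding A_def by (rule disjoint_family_disjointed)
  moreover have "c i \<in> K" if "i < n" for i
    using that C(1) bij_betw_imp_surj_on[OF c] by auto
  moreover have "dist x (c i) \<le> \<epsilon>" if "i < n" "x \<in> A i" for i x
    using that A_sub[of i] by (auto simp: dist_commute split: if_splits)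
  ultimately show ?thesis
    using that unfolding n_def by blast
qed

lemma tendsto_0_ennrealI:
  fixes f :: "nat \<Rightarrow> ennreal"
  assumes "\<And>e::real. 0 < e \<Longrightarrow> \<forall>\<^sub>F n in sequentially. f n \<le> ennreal e"
  shows "f \<longlonglongrightarrow> 0"
proof (rule order_tendstoI)
  fix a :: ennreal assume "0 < a"
  \<comment> \<open>An intermediate point is finite even if \<open>a\<close> is infinite, so it is a
    legitimate real tolerance.\<close>
  then obtain e where "0 < e" "e < a" using dense by blast
  then have "0 < enn2real e" "ennreal (enn2real e) < a"
    using order.strict_trans2[OF \<open>e < a\<close> top_greatest]
    by (auto simp: enn2real_positive_iff)
  then show "\<forall>\<^sub>F n in sequentially. f n < a"
    using assms[of "enn2real e"] by (auto elim: eventually_mono)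
qed simp

section \<open>Centered integrals for one fixed index, with \<open>N\<close> in the role of
  \<open>\<nu> n\<close>\<close>

locale prob_finite_pair = M: prob_space M + N: finite_measure N
  for M :: "'w measure" and N :: "'s measure"
begin

sublocale P: pair_sigma_finite M N ..

text \<open>By Fubini the expectations integrate over \<open>N\<close> to one deterministic
  constant. The identity holds only almost surely, since a slice of a jointly integrable field may
  fail to be integrable for a null set of \<open>\<omega>\<close>.\<close>

lemma centered_integral_eq:
  fixes X :: "'s \<Rightarrow> 'w \<Rightarrow> 'x::{banach, second_countable_topology}"
  assumes "integrable (M \<Otimes>\<^sub>M N) (\<lambda>(\<omega>, s). X s \<omega>)"
  shows "AE \<omega> in M. integrable N (\<lambda>s. X s \<omega> - (\<integral>\<omega>'. X s \<omega>' \<partial>M)) \<and>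
    centered_integral M N X \<omega> = (\<integral>s. X s \<omega> \<partial>N) - (\<integral>(\<omega>', s). X s \<omega>' \<partial>(M \<Otimes>\<^sub>M N))"
proof -
  have "integrable N (\<lambda>s. \<integral>\<omega>'. X s \<omega>' \<partial>M)"
    using P.integrable_snd[of "\<lambda>\<omega> s. X s \<omega>"] assms by simp
  moreover have "(\<integral>s. (\<integral>\<omega>'. X s \<omega>' \<partial>M) \<partial>N) = (\<integral>(\<omega>', s). X s \<omega>' \<partial>(M \<Otimes>\<^sub>M N))"
    using P.integral_snd[of "\<lambda>\<omega> s. X s \<omega>"] assms by simp
  ultimately show ?thesis
    using P.AE_integrable_fst[of "\<lambda>\<omega> s. X s \<omega>", OF assms]
    by (auto simp: centered_integral_def)
qed

text \<open>Additivity is claimed almost surely: where a slice is not integrable, the default value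
  0 of the Bochner integral can break it.\<close>

lemma centered_integral_add:
  fixes X Y :: "'s \<Rightarrow> 'w \<Rightarrow> 'x::{banach, second_countable_topology}"
  assumes X: "integrable (M \<Otimes>\<^sub>M N) (\<lambda>(\<omega>, s). X s \<omega>)"
    and Y: "integrable (M \<Otimes>\<^sub>M N) (\<lambda>(\<omega>, s). Y s \<omega>)"
  shows "AE \<omega> in M. centered_integral M N (\<lambda>s \<omega>. X s \<omega> + Y s \<omega>) \<omega> =
    centered_integral M N X \<omega> + centered_integral M N Y \<omega>"
proof -
  have eq: "(\<lambda>(\<omega>, s). X s \<omega> + Y s \<omega>) = (\<lambda>z. (\<lambda>(\<omega>, s). X s \<omega>) z + (\<lambda>(\<omega>, s). Y s \<omega>) z)"
    by auto
  have XY: "integrable (M \<Otimes>\<^sub>M N) (\<lambda>(\<omega>, s). X s \<omega> + Y s \<omega>)"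
    unfolding eq using X Y by (rule Bochner_Integration.integrable_add)
  have int: "(\<integral>(\<omega>, s). X s \<omega> + Y s \<omega> \<partial>(M \<Otimes>\<^sub>M N)) =
      (\<integral>(\<omega>, s). X s \<omega> \<partial>(M \<Otimes>\<^sub>M N)) + (\<integral>(\<omega>, s). Y s \<omega> \<partial>(M \<Otimes>\<^sub>M N))"
    unfolding eq using X Y by (rule Bochner_Integration.integral_add)
  show ?thesis
    using centered_integral_eq[OF X] centered_integral_eq[OF Y] centered_integral_eq[OF XY]
      P.AE_integrable_fst[of "\<lambda>\<omega> s. X s \<omega>", OF X] P.AE_integrable_fst[of "\<lambda>\<omega> s. Y s \<omega>", OF Y]
    by eventually_elim (simp add: int)
qed

lemma borel_measurable_centered_integral [measurable]:
  fixes X :: "'s \<Rightarrow> 'w \<Rightarrow> 'x::{banach, second_countable_topology}"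
  assumes [measurable]: "(\<lambda>(\<omega>, s). X s \<omega>) \<in> borel_measurable (M \<Otimes>\<^sub>M N)"
  shows "centered_integral M N X \<in> borel_measurable M"
proof -
  have [measurable]: "(\<lambda>(s, \<omega>). X s \<omega>) \<in> borel_measurable (N \<Otimes>\<^sub>M M)"
    using measurable_pair_swap[OF assms] by (simp add: case_prod_beta)
  show ?thesis
    unfolding centered_integral_def[abs_def] by measurable
qed

text \<open>Jensen over \<open>N\<close> costs C^(p-1), and separating the field from its
  expectation costs 2^p. Jensen over the probability space bounds the expectation by the same double
  integral as the field, which explains the last factor 2.\<close>

lemma nn_integral_centered_integral_le:
  fixes X :: "'s \<Rightarrow> 'w \<Rightarrow> 'x::{banach, second_countable_topology}"
  assumes X[measurable]: "(\<lambda>(\<omega>, s). X s \<omega>) \<in> borel_measurable (M \<Otimes>\<^sub>M N)"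
    and C: "measure N (space N) \<le> C" and p: "1 \<le> p"
  shows "(\<integral>\<^sup>+\<omega>. ennreal (norm (centered_integral M N X \<omega>) powr p) \<partial>M) \<le>
    ennreal (C powr (p - 1) * 2 powr (p + 1)) * (\<integral>\<^sup>+\<omega>. (\<integral>\<^sup>+s. ennreal (norm (X s \<omega>) powr p) \<partial>N) \<partial>M)"
proof -
  have X'[measurable]: "(\<lambda>(s, \<omega>). X s \<omega>) \<in> borel_measurable (N \<Otimes>\<^sub>M M)"
    using measurable_pair_swap[OF assms(1)] by (simp add: case_prod_beta)
  define J where "J = (\<integral>\<^sup>+\<omega>. (\<integral>\<^sup>+s. ennreal (norm (X s \<omega>) powr p) \<partial>N) \<partial>M)"
  have J': "J = (\<integral>\<^sup>+s. (\<integral>\<^sup>+\<omega>. ennreal (norm (X s \<omega>) powr p) \<partial>M) \<partial>N)"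
    unfolding J_def by (rule P.Fubini'[symmetric]) simp
  define E where "E s = (\<integral>\<omega>. X s \<omega> \<partial>M)" for s
  have [measurable]: "E \<in> borel_measurable N"
    unfolding E_def[abs_def] by measurable
  have E: "ennreal (norm (E s) powr p) \<le> (\<integral>\<^sup>+\<omega>. ennreal (norm (X s \<omega>) powr p) \<partial>M)"
    if [measurable]: "s \<in> space N" for s
  proof -
    have "norm (E s) powr p \<le> (\<integral>\<omega>. norm (X s \<omega>) \<partial>M) powr p"
      unfolding E_def using p by (intro powr_mono2 integral_norm_bound) auto
    then have "ennreal (norm (E s) powr p) \<le> ennreal ((\<integral>\<omega>. norm (X s \<omega>) \<partial>M) powr p)"
      by (rule ennreal_leI)
    also have "\<dots> \<le> ennreal (1 powr (p - 1)) * (\<integral>\<^sup>+\<omega>. ennreal (norm (X s \<omega>) powr p) \<partial>M)"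
      using p by (intro M.integral_powr_le) (auto simp: M.prob_space)
    finally show ?thesis by simp
  qed
  have "ennreal (norm (centered_integral M N X \<omega>) powr p) \<le> ennreal (C powr (p - 1) * 2 powr p) *
      ((\<integral>\<^sup>+s. ennreal (norm (X s \<omega>) powr p) \<partial>N) + J)" (is "?l \<le> _")
    if [measurable]: "\<omega> \<in> space M" for \<omega>
  proof -
    have "norm (centered_integral M N X \<omega>) powr p \<le> (\<integral>s. norm (X s \<omega> - E s) \<partial>N) powr p"
      unfolding centered_integral_def E_def using p by (intro powr_mono2 integral_norm_bound) auto
    then have "?l \<le> ennreal ((\<integral>s. norm (X s \<omega> - E s) \<partial>N) powr p)"
      by (rule ennreal_leI)
    also have "\<dots> \<le> ennreal (C powr (p - 1)) * (\<integral>\<^sup>+s. ennreal (norm (X s \<omega> - E s) powr p) \<partial>N)"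
      using p C by (intro N.integral_powr_le) auto
    also have "(\<integral>\<^sup>+s. ennreal (norm (X s \<omega> - E s) powr p) \<partial>N) \<le>
      (\<integral>\<^sup>+s. ennreal (2 powr p) * (ennreal (norm (X s \<omega>) powr p) + ennreal (norm (E s) powr p)) \<partial>N)"
    proof (intro nn_integral_mono)
      fix s
      have "norm (X s \<omega> - E s) powr p \<le> (norm (X s \<omega>) + norm (E s)) powr p"
        using p by (intro powr_mono2 norm_triangle_ineq4) auto
      also have "\<dots> \<le> 2 powr p * (norm (X s \<omega>) powr p + norm (E s) powr p)"
        using p by (intro powr_add_le) auto
      finally show "ennreal (norm (X s \<omega> - E s) powr p) \<le>
          ennreal (2 powr p) * (ennreal (norm (X s \<omega>) powr p) + ennreal (norm (E s) powr p))"
        by (simp add: ennreal_leI flip: ennreal_mult ennreal_plus)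
    qed
    also have "\<dots> = ennreal (2 powr p) * ((\<integral>\<^sup>+s. ennreal (norm (X s \<omega>) powr p) \<partial>N) +
        (\<integral>\<^sup>+s. ennreal (norm (E s) powr p) \<partial>N))"
      by (simp add: nn_integral_cmult nn_integral_add)
    also have "(\<integral>\<^sup>+s. ennreal (norm (E s) powr p) \<partial>N) \<le> J"
      unfolding J' by (intro nn_integral_mono E)
    finally show ?thesis
      by (simp add: ennreal_mult mult.assoc mult_left_mono add_left_mono)
  qed
  then have "(\<integral>\<^sup>+\<omega>. ennreal (norm (centered_integral M N X \<omega>) powr p) \<partial>M) \<le>
      (\<integral>\<^sup>+\<omega>. ennreal (C powr (p - 1) * 2 powr p) *
      ((\<integral>\<^sup>+s. ennreal (norm (X s \<omega>) powr p) \<partial>N) + J) \<partial>M)"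
    by (intro nn_integral_mono)
  also have "\<dots> = ennreal (C powr (p - 1) * 2 powr p) * (J + J)"
    by (simp add: nn_integral_cmult nn_integral_add M.emeasure_space_1 J_def[symmetric])
  also have "\<dots> = ennreal (C powr (p - 1) * 2 powr (p + 1)) * J"
    by (simp add: powr_add ennreal_mult mult_2[symmetric] mult.assoc)
  finally show ?thesis by (simp add: J_def)
qed

section \<open>Second moments of centered occupation measures\<close>

lemma integral_centered_integral_square:
  fixes f :: "'s \<Rightarrow> 'w \<Rightarrow> real"
  assumes f[measurable]: "(\<lambda>(\<omega>, s). f s \<omega>) \<in> borel_measurable (M \<Otimes>\<^sub>M N)"
    and bound: "\<And>s \<omega>. \<bar>f s \<omega>\<bar> \<le> B"
  shows "(\<integral>\<omega>. (centered_integral M N f \<omega>)\<^sup>2 \<partial>M) =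
    (\<integral>(s, t). (\<integral>\<omega>. f s \<omega> * f t \<omega> \<partial>M) - (\<integral>\<omega>. f s \<omega> \<partial>M) * (\<integral>\<omega>. f t \<omega> \<partial>M) \<partial>(N \<Otimes>\<^sub>M N))"
proof -
  interpret NN: finite_measure "N \<Otimes>\<^sub>M N"
    by (rule finite_measure_pair_measure) (rule N.finite_measure_axioms)+
  interpret PN: pair_sigma_finite N N ..
  interpret MNN: pair_sigma_finite M "N \<Otimes>\<^sub>M N" ..
  interpret MNNf: finite_measure "M \<Otimes>\<^sub>M (N \<Otimes>\<^sub>M N)"
    by (rule finite_measure_pair_measure) (rule M.finite_measure_axioms NN.finite_measure_axioms)+
  have f'[measurable]: "(\<lambda>(s, \<omega>). f s \<omega>) \<in> borel_measurable (N \<Otimes>\<^sub>M M)"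
    using measurable_pair_swap[OF f] by (simp add: case_prod_beta)
  have B: "0 \<le> B" using bound[of undefined undefined] by linarith
  define E where "E s = (\<integral>\<omega>. f s \<omega> \<partial>M)" for s
  have E_meas[measurable]: "E \<in> borel_measurable N"
    unfolding E_def[abs_def] by measurable
  have int_f: "integrable M (f s)" if [measurable]: "s \<in> space N" for s
    using bound by (intro M.integrable_const_bound[where B = B]) auto
  have int_ff: "integrable M (\<lambda>\<omega>. f s \<omega> * f t \<omega>)"
    if [measurable]: "s \<in> space N" "t \<in> space N" for s t
    using bound B by (intro M.integrable_const_bound[where B = "B * B"])
      (auto simp: abs_mult intro!: mult_mono)
  have E_bound: "\<bar>E s\<bar> \<le> B" for s
  proof -
    have "\<bar>E s\<bar> \<le> (\<integral>\<omega>. \<bar>f s \<omega>\<bar> \<partial>M)"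
      unfolding E_def by (rule integral_abs_bound)
    also have "\<dots> \<le> (\<integral>\<omega>. B \<partial>M)"
      using bound B by (intro integral_mono') auto
    finally show ?thesis by (simp add: M.prob_space)
  qed
  define g where "g s \<omega> = f s \<omega> - E s" for s \<omega>
  have g_bound: "\<bar>g s \<omega>\<bar> \<le> 2 * B" for s \<omega>
    using bound[of s \<omega>] E_bound[of s] by (simp add: g_def)
  have g_meas[measurable]: "(\<lambda>(\<omega>, s). g s \<omega>) \<in> borel_measurable (M \<Otimes>\<^sub>M N)"
    unfolding g_def by measurable
  have gg_bound: "\<bar>g s \<omega> * g t \<omega>\<bar> \<le> (2 * B) * (2 * B)" for s t \<omega>
    unfolding abs_mult using g_bound B by (intro mult_mono) auto
  \<comment> \<open>The square of an integral is a double integral over the product of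
    \<open>N\<close> with itself. Exchanging it with the expectation then produces the covariance of
    \<open>f s\<close> and \<open>f t\<close>; boundedness on finite measures justifies every
    exchange.\<close>
  have sq: "(centered_integral M N f \<omega>)\<^sup>2 = (\<integral>z. g (fst z) \<omega> * g (snd z) \<omega> \<partial>(N \<Otimes>\<^sub>M N))"
    if [measurable]: "\<omega> \<in> space M" for \<omega>
  proof -
    have "integrable (N \<Otimes>\<^sub>M N) (\<lambda>z. g (fst z) \<omega> * g (snd z) \<omega>)"
      using gg_bound by (intro NN.integrable_const_bound[where B = "2 * B * (2 * B)"]) auto
    then have "(\<integral>z. g (fst z) \<omega> * g (snd z) \<omega> \<partial>(N \<Otimes>\<^sub>M N)) = (\<integral>s. (\<integral>t. g s \<omega> * g t \<omega> \<partial>N) \<partial>N)"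
      by (subst PN.integral_fst'[symmetric]) auto
    then show ?thesis
      by (simp add: centered_integral_def g_def E_def power2_eq_square)
  qed
  have "(\<integral>\<omega>. (centered_integral M N f \<omega>)\<^sup>2 \<partial>M) =
      (\<integral>\<omega>. (\<integral>z. g (fst z) \<omega> * g (snd z) \<omega> \<partial>(N \<Otimes>\<^sub>M N)) \<partial>M)"
    by (intro Bochner_Integration.integral_cong refl sq)
  also have "\<dots> = (\<integral>z. (\<integral>\<omega>. g (fst z) \<omega> * g (snd z) \<omega> \<partial>M) \<partial>(N \<Otimes>\<^sub>M N))"
    using gg_bound
    by (intro MNN.Fubini_integral[symmetric] MNNf.integrable_const_bound[where B = "2 * B * (2 * B)"]) auto
  also have "\<dots> = (\<integral>z. (\<integral>\<omega>. f (fst z) \<omega> * f (snd z) \<omega> \<partial>M) - E (fst z) * E (snd z) \<partial>(N \<Otimes>\<^sub>M N))"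
  proof (intro Bochner_Integration.integral_cong refl)
    fix z assume "z \<in> space (N \<Otimes>\<^sub>M N)"
    then have z: "fst z \<in> space N" "snd z \<in> space N"
      by (auto simp: space_pair_measure)
    have "(\<integral>\<omega>. g (fst z) \<omega> * g (snd z) \<omega> \<partial>M) =
        (\<integral>\<omega>. f (fst z) \<omega> * f (snd z) \<omega> - E (snd z) * f (fst z) \<omega> - E (fst z) * f (snd z) \<omega> +
          E (fst z) * E (snd z) \<partial>M)"
      by (simp add: g_def algebra_simps)
    also have "\<dots> = (\<integral>\<omega>. f (fst z) \<omega> * f (snd z) \<omega> \<partial>M) - E (fst z) * E (snd z)"
      using z int_f int_ff by (simp add: M.prob_space E_def[symmetric] algebra_simps)
    finally show "(\<integral>\<omega>. g (fst z) \<omega> * g (snd z) \<omega> \<partial>M) =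
        (\<integral>\<omega>. f (fst z) \<omega> * f (snd z) \<omega> \<partial>M) - E (fst z) * E (snd z)" .
  qed
  finally show ?thesis
    by (simp add: E_def case_prod_beta')
qed

text \<open>Off \<open>D\<close> the covariance of the two indicators is nonpositive; on \<open>D\<close> it is at most the joint
  probability.\<close>

lemma centered_occupation_variance_le:
  fixes X :: "'s \<Rightarrow> 'w \<Rightarrow> 'x::topological_space"
  assumes X[measurable]: "(\<lambda>(\<omega>, s). X s \<omega>) \<in> borel_measurable (M \<Otimes>\<^sub>M N)"
    and D[measurable]: "D \<in> sets (N \<Otimes>\<^sub>M N)"
    and dep: "AE (s, t) in N \<Otimes>\<^sub>M N. (s, t) \<notin> D \<longrightarrow> diag_neg_dependent M (X s) (X t)"
    and A[measurable]: "A \<in> sets borel"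
  shows "(\<integral>\<omega>. (centered_integral M N (\<lambda>s \<omega>. indicat_real A (X s \<omega>)) \<omega>)\<^sup>2 \<partial>M) \<le>
    (\<integral>(s, t). indicat_real D (s, t) * \<P>(\<omega> in M. X s \<omega> \<in> A \<and> X t \<omega> \<in> A) \<partial>(N \<Otimes>\<^sub>M N))"
proof -
  interpret NN: finite_measure "N \<Otimes>\<^sub>M N"
    by (rule finite_measure_pair_measure) (rule N.finite_measure_axioms)+
  have X'[measurable]: "(\<lambda>(s, \<omega>). X s \<omega>) \<in> borel_measurable (N \<Otimes>\<^sub>M M)"
    using measurable_pair_swap[OF X] by (simp add: case_prod_beta)
  define f where "f s \<omega> = indicat_real A (X s \<omega>)" for s \<omega>
  have f_meas: "(\<lambda>(\<omega>, s). f s \<omega>) \<in> borel_measurable (M \<Otimes>\<^sub>M N)"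
    unfolding f_def by measurable
  have f_bound: "\<bar>f s \<omega>\<bar> \<le> 1" for s \<omega>
    by (simp add: f_def indicator_def)
  have Ef: "(\<integral>\<omega>. f s \<omega> \<partial>M) = \<P>(\<omega> in M. X s \<omega> \<in> A)" if [measurable]: "s \<in> space N" for s
  proof -
    have "(\<integral>\<omega>. f s \<omega> \<partial>M) = (\<integral>\<omega>. indicat_real {\<omega>\<in>space M. X s \<omega> \<in> A} \<omega> \<partial>M)"
      by (intro Bochner_Integration.integral_cong) (auto simp: f_def indicator_def)
    then show ?thesis by simp
  qed
  have Eff: "(\<integral>\<omega>. f s \<omega> * f t \<omega> \<partial>M) = \<P>(\<omega> in M. X s \<omega> \<in> A \<and> X t \<omega> \<in> A)"
    if [measurable]: "s \<in> space N" "t \<in> space N" for s t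
  proof -
    have "(\<integral>\<omega>. f s \<omega> * f t \<omega> \<partial>M) = (\<integral>\<omega>. indicat_real {\<omega>\<in>space M. X s \<omega> \<in> A \<and> X t \<omega> \<in> A} \<omega> \<partial>M)"
      by (intro Bochner_Integration.integral_cong) (auto simp: f_def indicator_def)
    then show ?thesis by simp
  qed
  have "(\<integral>\<omega>. (centered_integral M N f \<omega>)\<^sup>2 \<partial>M) =
      (\<integral>(s, t). (\<integral>\<omega>. f s \<omega> * f t \<omega> \<partial>M) - (\<integral>\<omega>. f s \<omega> \<partial>M) * (\<integral>\<omega>. f t \<omega> \<partial>M) \<partial>(N \<Otimes>\<^sub>M N))"
    by (rule integral_centered_integral_square[OF f_meas f_bound])
  also have "\<dots> = (\<integral>z. \<P>(\<omega> in M. X (fst z) \<omega> \<in> A \<and> X (snd z) \<omega> \<in> A) -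
      \<P>(\<omega> in M. X (fst z) \<omega> \<in> A) * \<P>(\<omega> in M. X (snd z) \<omega> \<in> A) \<partial>(N \<Otimes>\<^sub>M N))"
    by (intro Bochner_Integration.integral_cong refl) (auto simp: Ef Eff space_pair_measure)
  also have "\<dots> \<le> (\<integral>z. indicat_real D z * \<P>(\<omega> in M. X (fst z) \<omega> \<in> A \<and> X (snd z) \<omega> \<in> A) \<partial>(N \<Otimes>\<^sub>M N))"
  proof (rule integral_mono_AE)
    show "integrable (N \<Otimes>\<^sub>M N) (\<lambda>z. \<P>(\<omega> in M. X (fst z) \<omega> \<in> A \<and> X (snd z) \<omega> \<in> A) -
        \<P>(\<omega> in M. X (fst z) \<omega> \<in> A) * \<P>(\<omega> in M. X (snd z) \<omega> \<in> A))"
      by (intro Bochner_Integration.integrable_diff NN.integrable_const_bound[where B = 1])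
        (auto simp: mult_le_one)
    show "integrable (N \<Otimes>\<^sub>M N)
        (\<lambda>z. indicat_real D z * \<P>(\<omega> in M. X (fst z) \<omega> \<in> A \<and> X (snd z) \<omega> \<in> A))"
      by (intro NN.integrable_const_bound[where B = 1]) (auto simp: mult_le_one)
    show "AE z in N \<Otimes>\<^sub>M N. \<P>(\<omega> in M. X (fst z) \<omega> \<in> A \<and> X (snd z) \<omega> \<in> A) -
        \<P>(\<omega> in M. X (fst z) \<omega> \<in> A) * \<P>(\<omega> in M. X (snd z) \<omega> \<in> A) \<le>
        indicat_real D z * \<P>(\<omega> in M. X (fst z) \<omega> \<in> A \<and> X (snd z) \<omega> \<in> A)"
      using dep
    proof eventually_elim
      case (elim z)
      then show ?case
        using A by (cases "z \<in> D") (auto simp: diag_neg_dependent_def case_prod_beta)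
    qed
  qed
  finally show ?thesis
    by (simp add: f_def[abs_def] case_prod_beta')
qed

text \<open>For a fixed pair (s, t) the events that both values lie in \<open>A i\<close> are
  disjoint in \<open>i\<close>, so their probabilities sum to at most 1. Summing before integrating
  over \<open>D\<close> thus avoids a factor \<open>card I\<close>.\<close>

lemma sum_centered_occupation_variance_le:
  fixes X :: "'s \<Rightarrow> 'w \<Rightarrow> 'x::topological_space" and A :: "'i \<Rightarrow> 'x set"
  assumes X[measurable]: "(\<lambda>(\<omega>, s). X s \<omega>) \<in> borel_measurable (M \<Otimes>\<^sub>M N)"
    and D[measurable]: "D \<in> sets (N \<Otimes>\<^sub>M N)"
    and dep: "AE (s, t) in N \<Otimes>\<^sub>M N. (s, t) \<notin> D \<longrightarrow> diag_neg_dependent M (X s) (X t)"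
    and A[measurable]: "\<And>i. A i \<in> sets borel" and disj: "disjoint_family_on A I" and I: "finite I"
  shows "(\<Sum>i\<in>I. \<integral>\<omega>. (centered_integral M N (\<lambda>s \<omega>. indicat_real (A i) (X s \<omega>)) \<omega>)\<^sup>2 \<partial>M) \<le>
    measure (N \<Otimes>\<^sub>M N) D"
proof -
  interpret NN: finite_measure "N \<Otimes>\<^sub>M N"
    by (rule finite_measure_pair_measure) (rule N.finite_measure_axioms)+
  have X'[measurable]: "(\<lambda>(s, \<omega>). X s \<omega>) \<in> borel_measurable (N \<Otimes>\<^sub>M M)"
    using measurable_pair_swap[OF X] by (simp add: case_prod_beta)
  let ?Q = "\<lambda>i z. \<P>(\<omega> in M. X (fst z) \<omega> \<in> A i \<and> X (snd z) \<omega> \<in> A i)"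
  have int: "integrable (N \<Otimes>\<^sub>M N) (\<lambda>z. indicat_real D z * ?Q i z)" for i
    by (intro NN.integrable_const_bound[where B = 1]) (auto simp: mult_le_one)
  have "(\<Sum>i\<in>I. \<integral>\<omega>. (centered_integral M N (\<lambda>s \<omega>. indicat_real (A i) (X s \<omega>)) \<omega>)\<^sup>2 \<partial>M) \<le>
      (\<Sum>i\<in>I. \<integral>z. indicat_real D z * ?Q i z \<partial>(N \<Otimes>\<^sub>M N))"
    using centered_occupation_variance_le[OF X D dep A]
    by (intro sum_mono) (simp add: case_prod_beta')
  also have "\<dots> = (\<integral>z. (\<Sum>i\<in>I. indicat_real D z * ?Q i z) \<partial>(N \<Otimes>\<^sub>M N))"
    using int by simp
  also have "\<dots> \<le> (\<integral>z. indicat_real D z \<partial>(N \<Otimes>\<^sub>M N))"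
  proof (intro integral_mono Bochner_Integration.integrable_sum int)
    show "integrable (N \<Otimes>\<^sub>M N) (indicat_real D)"
      by (intro NN.integrable_const_bound[where B = 1]) auto
    fix z assume "z \<in> space (N \<Otimes>\<^sub>M N)"
    then have [measurable]: "fst z \<in> space N" "snd z \<in> space N"
      by (auto simp: space_pair_measure)
    have "(\<Sum>i\<in>I. ?Q i z) = M.prob (\<Union>i\<in>I. {\<omega>\<in>space M. X (fst z) \<omega> \<in> A i \<and> X (snd z) \<omega> \<in> A i})"
      using disj I by (intro M.finite_measure_finite_Union[symmetric])
        (auto simp: disjoint_family_on_def)
    also have "\<dots> \<le> 1" by simp
    finally show "(\<Sum>i\<in>I. indicat_real D z * ?Q i z) \<le> indicat_real D z"
      by (auto simp: indicator_def simp flip: sum_distrib_left)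
  qed
  also have "\<dots> = measure (N \<Otimes>\<^sub>M N) D" by simp
  finally show ?thesis .
qed

lemma finite_measure_pair: "finite_measure (M \<Otimes>\<^sub>M N)"
  by (rule finite_measure_pair_measure) (rule M.finite_measure_axioms N.finite_measure_axioms)+

text \<open>The integrand is the difference of two numbers in [0, 1]. Measurability is not assumed:
  \<open>integral_mono'\<close> requires only the dominating constant to be integrable, as a
  nonintegrable function has integral 0.\<close>

lemma abs_centered_occupation_le:
  assumes C: "measure N (space N) \<le> C"
  shows "\<bar>centered_integral M N (\<lambda>s \<omega>. indicat_real A (X s \<omega>)) \<omega>\<bar> \<le> C"
proof -
  let ?g = "\<lambda>s. indicat_real A (X s \<omega>) - (\<integral>\<omega>'. indicat_real A (X s \<omega>') \<partial>M)"
  have le: "\<bar>?g s\<bar> \<le> 1" for s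
  proof -
    have "0 \<le> (\<integral>\<omega>'. indicat_real A (X s \<omega>') \<partial>M)"
      by (intro Bochner_Integration.integral_nonneg) simp
    moreover have "(\<integral>\<omega>'. indicat_real A (X s \<omega>') \<partial>M) \<le> (\<integral>\<omega>'. 1 \<partial>M)"
      by (intro integral_mono') (auto simp: indicator_def)
    ultimately show ?thesis
      by (simp add: M.prob_space indicator_def)
  qed
  have "\<bar>\<integral>s. ?g s \<partial>N\<bar> \<le> (\<integral>s. \<bar>?g s\<bar> \<partial>N)"
    by (rule integral_abs_bound)
  also have "\<dots> \<le> (\<integral>s. 1 \<partial>N)"
    using le by (intro integral_mono') auto
  finally show ?thesis
    using C by (simp add: centered_integral_def)
qed

text \<open>The moment of order \<open>q\<close> is estimated first, because
  \<open>q \<ge> 2\<close> allows it to be reduced to variances. Jensen on the probability space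
  then descends from order \<open>q\<close> to order \<open>p\<close>.\<close>

lemma nn_integral_centered_simple_le:
  fixes X :: "'s \<Rightarrow> 'w \<Rightarrow> 'x::{banach, second_countable_topology}" and A :: "'i \<Rightarrow> 'x set"
  assumes X[measurable]: "(\<lambda>(\<omega>, s). X s \<omega>) \<in> borel_measurable (M \<Otimes>\<^sub>M N)"
    and C: "measure N (space N) \<le> C"
    and D[measurable]: "D \<in> sets (N \<Otimes>\<^sub>M N)"
    and dep: "AE (s, t) in N \<Otimes>\<^sub>M N. (s, t) \<notin> D \<longrightarrow> diag_neg_dependent M (X s) (X t)"
    and A[measurable]: "\<And>i. A i \<in> sets borel" and disj: "disjoint_family_on A I" and I: "finite I"
    and R: "\<And>i. i \<in> I \<Longrightarrow> norm (c i) \<le> R" "0 \<le> R"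
    and p: "1 \<le> p" "p \<le> q" "2 \<le> q"
  shows "(\<integral>\<^sup>+\<omega>. ennreal (norm (centered_integral M N (\<lambda>s \<omega>. \<Sum>i\<in>I. indicat_real (A i) (X s \<omega>) *\<^sub>R c i) \<omega>) powr p) \<partial>M)
    \<le> ennreal ((real (card I) powr (1 - 1 / q) * R * measure (N \<Otimes>\<^sub>M N) D powr (1 / q) * C powr (1 - 2 / q)) powr p)"
proof -
  have X'[measurable]: "(\<lambda>(s, \<omega>). X s \<omega>) \<in> borel_measurable (N \<Otimes>\<^sub>M M)"
    using measurable_pair_swap[OF X] by (simp add: case_prod_beta)
  have C0: "0 \<le> C" using C measure_nonneg order_trans by blast
  define \<xi> where "\<xi> i = centered_integral M N (\<lambda>s \<omega>. indicat_real (A i) (X s \<omega>))" for i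
  define Y where "Y \<omega> = norm (centered_integral M N (\<lambda>s \<omega>. \<Sum>i\<in>I. indicat_real (A i) (X s \<omega>) *\<^sub>R c i) \<omega>)" for \<omega>
  have \<xi>_meas[measurable]: "\<xi> i \<in> borel_measurable M" for i
    unfolding \<xi>_def by measurable
  have Y_meas[measurable]: "Y \<in> borel_measurable M"
    unfolding Y_def by measurable
  have \<xi>_bound: "\<bar>\<xi> i \<omega>\<bar> \<le> C" for i \<omega>
    unfolding \<xi>_def using C by (rule abs_centered_occupation_le)
  \<comment> \<open>Bounded indicators are integrable on every slice, so linearity and this bound
    hold for each \<open>\<omega>\<close> and not merely almost surely.\<close>
  have Y_le: "Y \<omega> \<le> R * (\<Sum>i\<in>I. \<bar>\<xi> i \<omega>\<bar>)" if [measurable]: "\<omega> \<in> space M" for \<omega>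
  proof -
    have intM: "integrable M (\<lambda>\<omega>. indicat_real (A i) (X s \<omega>))" if [measurable]: "s \<in> space N" for i s
      by (intro M.integrable_const_bound[where B = 1]) auto
    have int1: "integrable N (\<lambda>s. indicat_real (A i) (X s \<omega>))" for i
      by (intro N.integrable_const_bound[where B = 1]) auto
    have int2: "integrable N (\<lambda>s. \<integral>\<omega>'. indicat_real (A i) (X s \<omega>') \<partial>M)" for i
    proof (intro N.integrable_const_bound[where B = 1] AE_I2)
      fix s assume "s \<in> space N"
      then have "(\<integral>\<omega>'. indicat_real (A i) (X s \<omega>') \<partial>M) \<le> (\<integral>\<omega>'. 1 \<partial>M)"
        by (intro integral_mono intM) (auto simp: indicator_def)
      then show "norm (\<integral>\<omega>'. indicat_real (A i) (X s \<omega>') \<partial>M) \<le> 1"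
        by (simp add: M.prob_space Bochner_Integration.integral_nonneg)
    qed measurable
    have "centered_integral M N (\<lambda>s \<omega>. \<Sum>i\<in>I. indicat_real (A i) (X s \<omega>) *\<^sub>R c i) \<omega> =
        (\<integral>s. (\<Sum>i\<in>I. (indicat_real (A i) (X s \<omega>) - (\<integral>\<omega>'. indicat_real (A i) (X s \<omega>') \<partial>M)) *\<^sub>R c i) \<partial>N)"
      unfolding centered_integral_def using intM
      by (intro Bochner_Integration.integral_cong)
        (simp_all add: sum_subtractf scaleR_diff_left)
    also have "\<dots> = (\<Sum>i\<in>I. \<xi> i \<omega> *\<^sub>R c i)"
      using int1 int2 by (simp add: \<xi>_def centered_integral_def)
    finally have "Y \<omega> \<le> (\<Sum>i\<in>I. norm (\<xi> i \<omega> *\<^sub>R c i))"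
      unfolding Y_def by (simp only: norm_sum)
    also have "\<dots> \<le> (\<Sum>i\<in>I. R * \<bar>\<xi> i \<omega>\<bar>)"
      using R by (intro sum_mono) (simp add: mult.commute[of R] mult_left_mono)
    finally show ?thesis by (simp add: sum_distrib_left)
  qed
  define m where "m = real (card I)"
  define d where "d = measure (N \<Otimes>\<^sub>M N) D"
  \<comment> \<open>The bound for the moment of order \<open>q\<close>: \<open>sum_powr_le\<close>
    contributes the power of \<open>m\<close>, the uniform bound on \<open>\<xi>\<close> the power
    of \<open>C\<close>, and the summed variances the factor \<open>d\<close>. Its q-th root is the
    base of the p-th power in the claim.\<close>
  define b where "b = R powr q * m powr (q - 1) * C powr (q - 2) * d"
  have b0: "0 \<le> b" by (simp add: b_def d_def)
  \<comment> \<open>All but two of the \<open>q\<close> powers are absorbed by the uniform bound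
    \<open>C\<close>, leaving a square whose expectation is a variance.\<close>
  have \<xi>_pow: "\<bar>\<xi> i \<omega>\<bar> powr q \<le> C powr (q - 2) * (\<xi> i \<omega>)\<^sup>2" for i \<omega>
  proof (cases "\<xi> i \<omega> = 0")
    case False
    have "\<bar>\<xi> i \<omega>\<bar> powr q = \<bar>\<xi> i \<omega>\<bar> powr (q - 2) * \<bar>\<xi> i \<omega>\<bar> powr 2"
      unfolding powr_add[symmetric] by simp
    also have "\<bar>\<xi> i \<omega>\<bar> powr 2 = (\<xi> i \<omega>)\<^sup>2"
      using False by (simp add: powr_numeral)
    also have "\<bar>\<xi> i \<omega>\<bar> powr (q - 2) \<le> C powr (q - 2)"
      using p \<xi>_bound by (intro powr_mono2) auto
    finally show ?thesis by (simp add: mult_right_mono)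
  qed simp
  have int_sq: "integrable M (\<lambda>\<omega>. (\<xi> i \<omega>)\<^sup>2)" for i
    using \<xi>_bound[of i] C0
    by (intro M.integrable_const_bound[where B = "C\<^sup>2"]) (auto simp: abs_le_square_iff[symmetric])
  have "(\<integral>\<^sup>+\<omega>. ennreal (Y \<omega> powr q) \<partial>M) \<le>
      (\<integral>\<^sup>+\<omega>. ennreal (R powr q * m powr (q - 1) * C powr (q - 2) * (\<Sum>i\<in>I. (\<xi> i \<omega>)\<^sup>2)) \<partial>M)"
  proof (intro nn_integral_mono ennreal_leI)
    fix \<omega> assume \<omega>: "\<omega> \<in> space M"
    have "Y \<omega> powr q \<le> (R * (\<Sum>i\<in>I. \<bar>\<xi> i \<omega>\<bar>)) powr q"
      using p Y_le[OF \<omega>] by (intro powr_mono2) (auto simp: Y_def)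
    also have "\<dots> = R powr q * (\<Sum>i\<in>I. \<bar>\<xi> i \<omega>\<bar>) powr q"
      by (simp add: powr_mult)
    also have "\<dots> \<le> R powr q * (m powr (q - 1) * (\<Sum>i\<in>I. \<bar>\<xi> i \<omega>\<bar> powr q))"
      unfolding m_def using p I by (intro mult_left_mono sum_powr_le) auto
    also have "\<dots> \<le> R powr q * (m powr (q - 1) * (\<Sum>i\<in>I. C powr (q - 2) * (\<xi> i \<omega>)\<^sup>2))"
      by (intro mult_left_mono sum_mono \<xi>_pow) auto
    finally show "Y \<omega> powr q \<le> R powr q * m powr (q - 1) * C powr (q - 2) * (\<Sum>i\<in>I. (\<xi> i \<omega>)\<^sup>2)"
      by (simp add: sum_distrib_left mult_ac)
  qed
  also have "\<dots> = ennreal (\<integral>\<omega>. R powr q * m powr (q - 1) * C powr (q - 2) * (\<Sum>i\<in>I. (\<xi> i \<omega>)\<^sup>2) \<partial>M)"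
    using int_sq by (intro nn_integral_eq_integral) (auto intro!: AE_I2 mult_nonneg_nonneg sum_nonneg)
  also have "\<dots> = ennreal (R powr q * m powr (q - 1) * C powr (q - 2) * (\<Sum>i\<in>I. \<integral>\<omega>. (\<xi> i \<omega>)\<^sup>2 \<partial>M))"
    using int_sq by simp
  also have "\<dots> \<le> ennreal b"
    unfolding b_def d_def \<xi>_def
    by (intro ennreal_leI mult_left_mono sum_centered_occupation_variance_le[OF X D dep A disj I]) auto
  finally have Yq: "(\<integral>\<^sup>+\<omega>. ennreal (Y \<omega> powr q) \<partial>M) \<le> ennreal b" .
  define a where "a = (\<integral>\<omega>. Y \<omega> powr p \<partial>M)"
  have a0: "0 \<le> a" unfolding a_def by (intro Bochner_Integration.integral_nonneg) simp
  have "integrable M (\<lambda>\<omega>. Y \<omega> powr p)"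
  proof (intro M.integrable_const_bound[where B = "(R * (\<Sum>i\<in>I. C)) powr p"] AE_I2)
    fix \<omega> assume "\<omega> \<in> space M"
    then have "Y \<omega> \<le> R * (\<Sum>i\<in>I. \<bar>\<xi> i \<omega>\<bar>)" by (rule Y_le)
    also have "\<dots> \<le> R * (\<Sum>i\<in>I. C)"
      using R \<xi>_bound by (intro mult_left_mono sum_mono) auto
    finally show "norm (Y \<omega> powr p) \<le> (R * (\<Sum>i\<in>I. C)) powr p"
      using p by (auto intro!: powr_mono2 simp: Y_def)
  qed simp
  then have Yp: "(\<integral>\<^sup>+\<omega>. ennreal (Y \<omega> powr p) \<partial>M) = ennreal a"
    unfolding a_def by (intro nn_integral_eq_integral) auto
  \<comment> \<open>Jensen with the exponent q/p, which is at least 1, applied to the p-th power of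
    \<open>Y\<close>; the total mass is 1, so no constant appears.\<close>
  have "ennreal (a powr (q / p)) \<le> ennreal (1 powr (q / p - 1)) * (\<integral>\<^sup>+\<omega>. ennreal ((Y \<omega> powr p) powr (q / p)) \<partial>M)"
    unfolding a_def using p by (intro M.integral_powr_le) (auto simp: M.prob_space)
  also have "\<dots> \<le> ennreal b"
    using Yq p by (simp add: powr_powr)
  finally have "a powr (q / p) \<le> b"
    using b0 by simp
  then have "(a powr (q / p)) powr (p / q) \<le> b powr (p / q)"
    using p by (intro powr_mono2) auto
  then have "a \<le> b powr (p / q)"
    using p a0 by (simp add: powr_powr)
  also have "b powr (p / q) = (b powr (1 / q)) powr p"
    by (simp add: powr_powr)
  also have "b powr (1 / q) = m powr (1 - 1 / q) * R * d powr (1 / q) * C powr (1 - 2 / q)"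
    using p R C0 by (simp add: b_def d_def powr_mult powr_powr diff_divide_distrib)
  finally show ?thesis
    using Yp by (simp add: Y_def m_def d_def ennreal_leI)
qed

section \<open>Truncation, rounding and the estimate for one index\<close>

lemma integrable_truncation:
  fixes X :: "'s \<Rightarrow> 'w \<Rightarrow> 'x::{banach, second_countable_topology}"
  assumes X[measurable]: "(\<lambda>(\<omega>, s). X s \<omega>) \<in> borel_measurable (M \<Otimes>\<^sub>M N)"
    and K[measurable]: "K \<in> sets borel" and R: "\<And>x. x \<in> K \<Longrightarrow> norm x \<le> R"
    and p: "1 \<le> p"
    and J: "(\<integral>\<^sup>+\<omega>. (\<integral>\<^sup>+s. ennreal (norm (X s \<omega>) powr p) * indicator (- K) (X s \<omega>) \<partial>N) \<partial>M) < \<top>"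
  shows "integrable (M \<Otimes>\<^sub>M N) (\<lambda>(\<omega>, s). indicat_real K (X s \<omega>) *\<^sub>R X s \<omega>)"
    and "integrable (M \<Otimes>\<^sub>M N) (\<lambda>(\<omega>, s). indicat_real (- K) (X s \<omega>) *\<^sub>R X s \<omega>)"
    and "integrable (M \<Otimes>\<^sub>M N) (\<lambda>(\<omega>, s). X s \<omega>)"
proof -
  interpret MN: finite_measure "M \<Otimes>\<^sub>M N" by (rule finite_measure_pair)
  \<comment> \<open>The maximum with 0 is needed since \<open>K\<close> may be empty here, in which
    case \<open>R\<close> may be negative.\<close>
  have "norm (indicat_real K x *\<^sub>R x) \<le> max 0 R" for x
    using R by (auto simp: indicator_def le_max_iff_disj)
  then show inside: "integrable (M \<Otimes>\<^sub>M N) (\<lambda>(\<omega>, s). indicat_real K (X s \<omega>) *\<^sub>R X s \<omega>)"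
    by (intro MN.integrable_const_bound[where B = "max 0 R"]) (auto simp: case_prod_beta)
  show outside: "integrable (M \<Otimes>\<^sub>M N) (\<lambda>(\<omega>, s). indicat_real (- K) (X s \<omega>) *\<^sub>R X s \<omega>)"
  proof (rule integrableI_bounded)
    \<comment> \<open>A norm is at most 1 or at most its own p-th power. The constant 1 is
      integrable because the product measure is finite.\<close>
    have "ennreal (norm (indicat_real (- K) x *\<^sub>R x)) \<le>
        1 + ennreal (norm x powr p) * indicator (- K) x" for x :: 'x
    proof (cases "x \<in> K \<or> norm x \<le> 1")
      case True
      then show ?thesis
        by (auto simp: indicator_def intro!: add_increasing2)
    next
      case False
      then have "norm x powr 1 \<le> norm x powr p"
        using p by (intro powr_mono) auto
      then have "ennreal (norm x) \<le> ennreal (norm x powr p)"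
        using False by (auto intro: ennreal_leI)
      then show ?thesis
        using False by (simp add: add_increasing)
    qed
    then have "(\<integral>\<^sup>+z. ennreal (norm (case z of (\<omega>, s) \<Rightarrow> indicat_real (- K) (X s \<omega>) *\<^sub>R X s \<omega>)) \<partial>(M \<Otimes>\<^sub>M N)) \<le>
        (\<integral>\<^sup>+z. 1 + (case z of (\<omega>, s) \<Rightarrow> ennreal (norm (X s \<omega>) powr p) * indicator (- K) (X s \<omega>)) \<partial>(M \<Otimes>\<^sub>M N))"
      by (intro nn_integral_mono) (auto simp: case_prod_beta)
    also have "\<dots> = emeasure (M \<Otimes>\<^sub>M N) (space (M \<Otimes>\<^sub>M N)) +
        (\<integral>\<^sup>+\<omega>. (\<integral>\<^sup>+s. ennreal (norm (X s \<omega>) powr p) * indicator (- K) (X s \<omega>) \<partial>N) \<partial>M)"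
      by (subst nn_integral_add) (auto simp: N.nn_integral_fst[symmetric])
    also have "\<dots> < \<infinity>"
      using J MN.emeasure_finite[unfolded less_top] by simp
    finally show "(\<integral>\<^sup>+z. ennreal (norm (case z of (\<omega>, s) \<Rightarrow> indicat_real (- K) (X s \<omega>) *\<^sub>R X s \<omega>)) \<partial>(M \<Otimes>\<^sub>M N)) < \<infinity>" .
  qed measurable
  have "(\<lambda>(\<omega>, s). X s \<omega>) = (\<lambda>z. (case z of (\<omega>, s) \<Rightarrow> indicat_real K (X s \<omega>) *\<^sub>R X s \<omega>) +
      (case z of (\<omega>, s) \<Rightarrow> indicat_real (- K) (X s \<omega>) *\<^sub>R X s \<omega>))"
    by (auto simp: indicator_def)
  then show "integrable (M \<Otimes>\<^sub>M N) (\<lambda>(\<omega>, s). X s \<omega>)"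
    using Bochner_Integration.integrable_add[OF inside outside] by simp
qed

text \<open>On \<open>K\<close> the field is replaced by the centers of a minimal \<open>\<epsilon>\<close>-cover. The three terms come from
  the part of the field outside \<open>K\<close>, from the discretization error, and from the discretized field.\<close>

lemma nn_integral_centered_integral_decomposition_le:
  fixes X :: "'s \<Rightarrow> 'w \<Rightarrow> 'x::{banach, second_countable_topology}"
  assumes X[measurable]: "(\<lambda>(\<omega>, s). X s \<omega>) \<in> borel_measurable (M \<Otimes>\<^sub>M N)"
    and C: "measure N (space N) \<le> C"
    and D[measurable]: "D \<in> sets (N \<Otimes>\<^sub>M N)"
    and dep: "AE (s, t) in N \<Otimes>\<^sub>M N. (s, t) \<notin> D \<longrightarrow> diag_neg_dependent M (X s) (X t)"
    and K: "compact K" "K \<noteq> {}" and \<epsilon>: "0 < \<epsilon>"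
    and p: "1 \<le> p" "p \<le> q" "2 \<le> q"
    and J_def: "J = (\<integral>\<^sup>+\<omega>. (\<integral>\<^sup>+s. ennreal (norm (X s \<omega>) powr p) * indicator (- K) (X s \<omega>) \<partial>N) \<partial>M)"
    and J: "J < \<top>"
  shows "(\<integral>\<^sup>+\<omega>. ennreal (norm (centered_integral M N X \<omega>) powr p) \<partial>M) \<le> ennreal (4 powr p) *
    (ennreal (C powr (p - 1) * 2 powr (p + 1)) * J
     + (ennreal (C powr (p - 1) * 2 powr (p + 1)) * ennreal (\<epsilon> powr p * C)
     + ennreal ((real (covering_number K \<epsilon>) powr (1 - 1 / q) * set_norm K *
         measure (N \<Otimes>\<^sub>M N) D powr (1 / q) * C powr (1 - 2 / q)) powr p)))"
proof -
  interpret MN: finite_measure "M \<Otimes>\<^sub>M N" by (rule finite_measure_pair)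
  define n where "n = covering_number K \<epsilon>"
  define R where "R = set_norm K"
  have K_meas[measurable]: "K \<in> sets borel" using K(1) by (simp add: compact_imp_closed)
  have R: "norm x \<le> R" if "x \<in> K" for x
    using set_norm_attained[OF K] that by (auto simp: R_def)
  have R0: "0 \<le> R" using K(2) R norm_ge_zero order_trans by blast
  obtain A c where A_meas[measurable]: "\<And>i. A i \<in> sets borel" and disj: "disjoint_family A"
    and UN: "(\<Union>i<n. A i) = K" and c: "\<And>i. i < n \<Longrightarrow> c i \<in> K"
    and near: "\<And>i x. i < n \<Longrightarrow> x \<in> A i \<Longrightarrow> dist x (c i) \<le> \<epsilon>"
    using covering_number_partition[OF K \<epsilon>] unfolding n_def by metis
  \<comment> \<open>Rounds a point of \<open>K\<close> to the center of its cell and vanishes off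
    \<open>K\<close>. As all cells lie in \<open>K\<close>, the rounded truncation is a function of
    \<open>X\<close> itself, so negative dependence of the original field applies directly to the
    cells.\<close>
  define \<phi> where "\<phi> x = (\<Sum>i<n. indicat_real (A i) x *\<^sub>R c i)" for x
  have \<phi>_meas[measurable]: "\<phi> \<in> borel_measurable borel"
    unfolding \<phi>_def by measurable
  have \<phi>_in: "\<phi> x = c i" if "i < n" "x \<in> A i" for x i
  proof -
    have "indicat_real (A j) x *\<^sub>R c j = (if j = i then c i else 0)" for j
      using disj that by (auto simp: disjoint_family_on_def indicator_def)
    then show ?thesis using that by (simp add: \<phi>_def)
  qed
  have \<phi>_out: "\<phi> x = 0" if "x \<notin> K" for x
    using that UN by (auto simp: \<phi>_def indicator_def intro!: sum.neutral)
  have \<phi>_near: "norm (indicat_real K x *\<^sub>R x - \<phi> x) \<le> \<epsilon>" for x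
  proof (cases "x \<in> K")
    case True
    with UN obtain i where "i < n" "x \<in> A i" by blast
    with near[of i x] True show ?thesis by (simp add: \<phi>_in dist_norm)
  qed (use \<epsilon> \<phi>_out in simp)
  have \<phi>_norm: "norm (\<phi> x) \<le> R" for x
  proof (cases "x \<in> K")
    case True
    with UN obtain i where "i < n" "x \<in> A i" by blast
    with R c show ?thesis by (simp add: \<phi>_in)
  qed (use R0 \<phi>_out in simp)
  define U where "U s \<omega> = indicat_real K (X s \<omega>) *\<^sub>R X s \<omega>" for s \<omega>
  define W where "W s \<omega> = indicat_real (- K) (X s \<omega>) *\<^sub>R X s \<omega>" for s \<omega>
  define Z where "Z s \<omega> = \<phi> (X s \<omega>)" for s \<omega>
  define V where "V s \<omega> = U s \<omega> - Z s \<omega>" for s \<omega>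
  note trunc = integrable_truncation[OF X K_meas R p(1) J[unfolded J_def]]
  have U: "integrable (M \<Otimes>\<^sub>M N) (\<lambda>(\<omega>, s). U s \<omega>)"
    unfolding U_def by (rule trunc)
  have W: "integrable (M \<Otimes>\<^sub>M N) (\<lambda>(\<omega>, s). W s \<omega>)"
    unfolding W_def by (rule trunc)
  have Z: "integrable (M \<Otimes>\<^sub>M N) (\<lambda>(\<omega>, s). Z s \<omega>)"
    unfolding Z_def using \<phi>_norm
    by (intro MN.integrable_const_bound[where B = R]) (auto simp: case_prod_beta)
  have V: "integrable (M \<Otimes>\<^sub>M N) (\<lambda>(\<omega>, s). V s \<omega>)"
    using Bochner_Integration.integrable_diff[OF U Z] by (simp add: V_def case_prod_beta')
  have VZ: "integrable (M \<Otimes>\<^sub>M N) (\<lambda>(\<omega>, s). V s \<omega> + Z s \<omega>)"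
    using U by (simp add: V_def)
  \<comment> \<open>\<open>W\<close> is the tail controlled by \<open>J\<close>, \<open>V\<close>
    the rounding error of norm at most \<open>\<epsilon>\<close>, and \<open>Z\<close> takes
    finitely many values.\<close>
  have X_eq: "X = (\<lambda>s \<omega>. W s \<omega> + (V s \<omega> + Z s \<omega>))"
    by (intro ext) (simp add: V_def U_def W_def indicator_def)
  let ?c = "\<lambda>Y \<omega>. ennreal (norm (centered_integral M N Y \<omega>) powr p)"
  have [measurable]: "(\<lambda>(\<omega>, s). W s \<omega>) \<in> borel_measurable (M \<Otimes>\<^sub>M N)"
      "(\<lambda>(\<omega>, s). V s \<omega>) \<in> borel_measurable (M \<Otimes>\<^sub>M N)"
      "(\<lambda>(\<omega>, s). Z s \<omega>) \<in> borel_measurable (M \<Otimes>\<^sub>M N)"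
    using W V Z by (auto dest: borel_measurable_integrable)
  have "AE \<omega> in M. centered_integral M N X \<omega> =
      centered_integral M N W \<omega> + (centered_integral M N V \<omega> + centered_integral M N Z \<omega>)"
    unfolding X_eq using centered_integral_add[OF W VZ] centered_integral_add[OF V Z]
    by eventually_elim simp
  then have "AE \<omega> in M. ?c X \<omega> \<le> ennreal (4 powr p) * (?c W \<omega> + (?c V \<omega> + ?c Z \<omega>))"
  proof eventually_elim
    case (elim \<omega>)
    let ?w = "norm (centered_integral M N W \<omega>)" and ?v = "norm (centered_integral M N V \<omega>)"
      and ?z = "norm (centered_integral M N Z \<omega>)"
    have four: "4 powr p = 2 powr p * 2 powr p"
      unfolding powr_mult[symmetric] by simp
    have "1 \<le> 2 powr p"
      using p by (simp add: ge_one_powr_ge_zero)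
    then have two: "?w powr p \<le> 2 powr p * ?w powr p"
      using mult_right_mono[of 1 "2 powr p" "?w powr p"] by simp
    have "norm (centered_integral M N X \<omega>) powr p \<le> (?w + (?v + ?z)) powr p"
      unfolding elim using p
      by (intro powr_mono2 order_trans[OF norm_triangle_ineq] add_left_mono norm_triangle_ineq) auto
    also have "\<dots> \<le> 2 powr p * (?w powr p + (?v + ?z) powr p)"
      using p by (intro powr_add_le) auto
    also have "\<dots> \<le> 2 powr p * (2 powr p * ?w powr p + 2 powr p * (?v powr p + ?z powr p))"
      using p two by (intro mult_left_mono add_mono powr_add_le) auto
    also have "\<dots> = 4 powr p * (?w powr p + (?v powr p + ?z powr p))"
      by (simp only: four distrib_left mult.assoc)
    finally have "?c X \<omega> \<le> ennreal (4 powr p * (?w powr p + (?v powr p + ?z powr p)))"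
      by (rule ennreal_leI)
    then show ?case
      by (simp add: ennreal_mult)
  qed
  then have "(\<integral>\<^sup>+\<omega>. ?c X \<omega> \<partial>M) \<le> (\<integral>\<^sup>+\<omega>. ennreal (4 powr p) * (?c W \<omega> + (?c V \<omega> + ?c Z \<omega>)) \<partial>M)"
    by (rule nn_integral_mono_AE)
  also have "\<dots> = ennreal (4 powr p) * ((\<integral>\<^sup>+\<omega>. ?c W \<omega> \<partial>M) + ((\<integral>\<^sup>+\<omega>. ?c V \<omega> \<partial>M) + (\<integral>\<^sup>+\<omega>. ?c Z \<omega> \<partial>M)))"
    by (simp add: nn_integral_cmult nn_integral_add)
  also have "\<dots> \<le> ennreal (4 powr p) * (ennreal (C powr (p - 1) * 2 powr (p + 1)) * J
     + (ennreal (C powr (p - 1) * 2 powr (p + 1)) * ennreal (\<epsilon> powr p * C)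
     + ennreal ((real n powr (1 - 1 / q) * R *
         measure (N \<Otimes>\<^sub>M N) D powr (1 / q) * C powr (1 - 2 / q)) powr p)))"
  proof (intro mult_left_mono add_mono)
    have "(\<integral>\<^sup>+\<omega>. (\<integral>\<^sup>+s. ennreal (norm (W s \<omega>) powr p) \<partial>N) \<partial>M) = J"
      unfolding J_def W_def by (intro nn_integral_cong) (auto simp: indicator_def)
    then show "(\<integral>\<^sup>+\<omega>. ?c W \<omega> \<partial>M) \<le> ennreal (C powr (p - 1) * 2 powr (p + 1)) * J"
      using nn_integral_centered_integral_le[of W C p] C p by simp
    have "(\<integral>\<^sup>+\<omega>. (\<integral>\<^sup>+s. ennreal (norm (V s \<omega>) powr p) \<partial>N) \<partial>M) \<le>
        (\<integral>\<^sup>+\<omega>. (\<integral>\<^sup>+s. ennreal (\<epsilon> powr p) \<partial>N) \<partial>M)"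
      using \<phi>_near p unfolding V_def U_def Z_def
      by (intro nn_integral_mono ennreal_leI powr_mono2) auto
    also have "\<dots> = ennreal (\<epsilon> powr p * measure N (space N))"
      by (simp add: M.emeasure_space_1 N.emeasure_eq_measure ennreal_mult)
    also have "\<dots> \<le> ennreal (\<epsilon> powr p * C)"
      using C by (intro ennreal_leI mult_left_mono) auto
    finally have V_le: "(\<integral>\<^sup>+\<omega>. (\<integral>\<^sup>+s. ennreal (norm (V s \<omega>) powr p) \<partial>N) \<partial>M) \<le> ennreal (\<epsilon> powr p * C)" .
    have "(\<integral>\<^sup>+\<omega>. ?c V \<omega> \<partial>M) \<le> ennreal (C powr (p - 1) * 2 powr (p + 1)) *
        (\<integral>\<^sup>+\<omega>. (\<integral>\<^sup>+s. ennreal (norm (V s \<omega>) powr p) \<partial>N) \<partial>M)"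
      using C p by (intro nn_integral_centered_integral_le) auto
    also have "\<dots> \<le> ennreal (C powr (p - 1) * 2 powr (p + 1)) * ennreal (\<epsilon> powr p * C)"
      using V_le by (rule mult_left_mono) simp
    finally show "(\<integral>\<^sup>+\<omega>. ?c V \<omega> \<partial>M) \<le>
        ennreal (C powr (p - 1) * 2 powr (p + 1)) * ennreal (\<epsilon> powr p * C)" .
    have "disjoint_family_on A {..<n}"
      using disj by (rule disjoint_family_on_mono[rotated]) simp
    then show "(\<integral>\<^sup>+\<omega>. ?c Z \<omega> \<partial>M) \<le> ennreal ((real n powr (1 - 1 / q) * R *
         measure (N \<Otimes>\<^sub>M N) D powr (1 / q) * C powr (1 - 2 / q)) powr p)"
      using nn_integral_centered_simple_le[where A = A and I = "{..<n}" and c = c and R = R,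
          OF X C D dep A_meas _ _ _ R0 p] R c
      by (simp add: Z_def[abs_def] \<phi>_def)
  qed simp_all
  finally show ?thesis by (simp add: n_def R_def)
qed

end

section \<open>Passage to the limit\<close>

theorem theorem3p10:
  fixes M :: "'w measure"
    and \<nu> :: "nat \<Rightarrow> 's measure"
    and K :: "nat \<Rightarrow> 'x::{banach, second_countable_topology} set"
    and X :: "nat \<Rightarrow> 's \<Rightarrow> 'w \<Rightarrow> 'x"
    and D :: "nat \<Rightarrow> ('s \<times> 's) set"
    and p :: real
  assumes "prob_space M" and "complete_measure M"
    and "\<forall>n\<ge>1. finite_measure (\<nu> n)"
    and "0 < (SUP n\<in>{1..}. emeasure (\<nu> n) (space (\<nu> n)))"
    and "(SUP n\<in>{1..}. emeasure (\<nu> n) (space (\<nu> n))) < \<infinity>"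
    and "\<forall>n\<ge>1. compact (K n) \<and> K n \<noteq> {}"
    and "1 \<le> p"
    and "CUI M \<nu> p K X"
    and "\<forall>n\<ge>1. D n \<in> sets (\<nu> n \<Otimes>\<^sub>M \<nu> n)"
    and "\<forall>\<epsilon>>0. (\<lambda>n. real (covering_number (K n) \<epsilon>) powr (1 - min (1 / p) (1 / 2)) * set_norm (K n)
            * measure (\<nu> n \<Otimes>\<^sub>M \<nu> n) (D n) powr (min (1 / p) (1 / 2))) \<longlonglongrightarrow> 0"
    and "\<forall>n\<ge>1. AE (s, t) in \<nu> n \<Otimes>\<^sub>M \<nu> n. (s, t) \<notin> D n \<longrightarrow> diag_neg_dependent M (X n s) (X n t)"
  shows "(\<forall>\<^sub>F n in sequentially.
            (AE s in \<nu> n. integrable M (X n s)) \<and>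
            (AE \<omega> in M. integrable (\<nu> n) (\<lambda>s. X n s \<omega> - (\<integral>\<omega>'. X n s \<omega>' \<partial>M))))
      \<and> (\<lambda>n. \<integral>\<^sup>+\<omega>. ennreal (norm (centered_integral M (\<nu> n) (X n) \<omega>) powr p) \<partial>M) \<longlonglongrightarrow> 0
      \<and> (\<forall>\<epsilon>>0. (\<lambda>n. \<P>(\<omega> in M. norm (centered_integral M (\<nu> n) (X n) \<omega>) > \<epsilon>)) \<longlonglongrightarrow> 0)"
proof -
  interpret M: prob_space M by fact
  define q where "q = max p 2"
  have q: "p \<le> q" "2 \<le> q" and min_eq: "min (1 / p) (1 / 2) = 1 / q"
    using \<open>1 \<le> p\<close> by (auto simp: q_def min_def max_def field_simps)
  \<comment> \<open>The supremum is finite by hypothesis, so \<open>enn2real\<close> loses nothing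
    and \<open>C\<close> dominates all the masses.\<close>
  define C where "C = enn2real (SUP n\<in>{1..}. emeasure (\<nu> n) (space (\<nu> n)))"
  have C: "measure (\<nu> n) (space (\<nu> n)) \<le> C" if "n \<ge> 1" for n
    unfolding C_def measure_def using assms(5) that
    by (intro enn2real_mono SUP_upper) auto
  have C0: "0 \<le> C" by (simp add: C_def)
  define J where "J n = (\<integral>\<^sup>+\<omega>. (\<integral>\<^sup>+s. ennreal (norm (X n s \<omega>) powr p) * indicator (- K n) (X n s \<omega>) \<partial>\<nu> n) \<partial>M)" for n
  have J: "J \<longlonglongrightarrow> 0"
    using \<open>CUI M \<nu> p K X\<close> by (simp add: CUI_def J_def[abs_def])
  \<comment> \<open>Convergence to 0 makes the tail integral finite only eventually; this determines
    from which index the expectations and integrals exist.\<close>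
  have J_fin: "\<forall>\<^sub>F n in sequentially. n \<ge> 1 \<and> J n < \<top>"
    using eventually_ge_at_top[of 1] order_tendstoD(2)[OF J, of \<top>] by (simp add: eventually_conj_iff)
  have pair: "prob_finite_pair M (\<nu> n)" if "n \<ge> 1" for n
    using assms(1,3) that by (simp add: prob_finite_pair_def)
  have X_meas: "(\<lambda>(\<omega>, s). X n s \<omega>) \<in> borel_measurable (M \<Otimes>\<^sub>M \<nu> n)" if "n \<ge> 1" for n
    using \<open>CUI M \<nu> p K X\<close> that by (simp add: CUI_def)
  have integrable: "(AE s in \<nu> n. integrable M (X n s)) \<and>
      (AE \<omega> in M. integrable (\<nu> n) (\<lambda>s. X n s \<omega> - (\<integral>\<omega>'. X n s \<omega>' \<partial>M)))"
    if n: "n \<ge> 1" "J n < \<top>" for n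
  proof -
    interpret prob_finite_pair M "\<nu> n" using n(1) by (rule pair)
    have K: "compact (K n)" "K n \<noteq> {}" using assms(6) n by auto
    have int: "integrable (M \<Otimes>\<^sub>M \<nu> n) (\<lambda>(\<omega>, s). X n s \<omega>)"
      using set_norm_attained[OF K] K(1) \<open>1 \<le> p\<close> n
      by (intro integrable_truncation(3)[where K = "K n" and R = "set_norm (K n)" and p = p] X_meas)
        (auto simp: J_def compact_imp_closed)
    show ?thesis
      using P.AE_integrable_snd[of "\<lambda>\<omega> s. X n s \<omega>", OF int] centered_integral_eq[OF int]
      by (auto elim: eventually_mono)
  qed
  define T where "T n = (\<integral>\<^sup>+\<omega>. ennreal (norm (centered_integral M (\<nu> n) (X n) \<omega>) powr p) \<partial>M)" for n
  define L where "L = C powr (p - 1) * 2 powr (p + 1)"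
  define b where "b \<epsilon> n = real (covering_number (K n) \<epsilon>) powr (1 - 1 / q) * set_norm (K n) *
      measure (\<nu> n \<Otimes>\<^sub>M \<nu> n) (D n) powr (1 / q) * C powr (1 - 2 / q)" for \<epsilon> n
  \<comment> \<open>Hypothesis (a) multiplied by a constant. Continuity of the power at 0 requires
    eventually nonnegative terms; index 0 is excluded because \<open>K 0\<close> is
    unconstrained.\<close>
  have b: "(\<lambda>n. b \<epsilon> n powr p) \<longlonglongrightarrow> 0" if "0 < \<epsilon>" for \<epsilon>
  proof -
    have "b \<epsilon> \<longlonglongrightarrow> 0 * C powr (1 - 2 / q)"
      unfolding b_def[abs_def] using assms(10) that unfolding min_eq by (intro tendsto_mult_right) simp
    moreover have "0 \<le> set_norm (K n)" if "n \<ge> 1" for n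
      using set_norm_attained[of "K n"] assms(6) that by (metis norm_ge_zero)
    then have "\<forall>\<^sub>F n in sequentially. 0 \<le> b \<epsilon> n"
      by (auto simp: b_def intro!: eventually_sequentiallyI[of 1])
    ultimately have "(\<lambda>n. b \<epsilon> n powr p) \<longlonglongrightarrow> 0 powr p"
      using \<open>1 \<le> p\<close> by (intro tendsto_powr2[of _ 0]) auto
    then show ?thesis by simp
  qed
  have bound: "T n \<le> ennreal (4 powr p) * (ennreal L * J n + (ennreal L * ennreal (\<epsilon> powr p * C) + ennreal (b \<epsilon> n powr p)))"
    if n: "n \<ge> 1" "J n < \<top>" and \<epsilon>: "0 < \<epsilon>" for n \<epsilon>
  proof -
    interpret prob_finite_pair M "\<nu> n" using n(1) by (rule pair)
    show ?thesis
      unfolding T_def L_def b_def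
      using assms(6,9,11) n \<open>1 \<le> p\<close> q \<epsilon> C[OF n(1)] X_meas[OF n(1)]
      by (intro nn_integral_centered_integral_decomposition_le) (auto simp: J_def)
  qed
  have T: "T \<longlonglongrightarrow> 0"
  proof (rule tendsto_0_ennrealI)
    fix e :: real assume e: "0 < e"
    \<comment> \<open>An equal share of \<open>e\<close> for each of the three terms, after the
      common factor 4^p.\<close>
    define e' where "e' = e / (3 * 4 powr p)"
    have e': "0 < e'" using e by (simp add: e'_def)
    \<comment> \<open>Makes the rounding term at most \<open>e'\<close> for every \<open>n\<close>;
      the added 1 prevents division by 0. Only after \<open>\<epsilon>\<close> is fixed is
      \<open>n\<close> taken large for the other two terms.\<close>
    define \<epsilon> where "\<epsilon> = (e' / (L * C + 1)) powr (1 / p)"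
    have L0: "0 \<le> L" by (simp add: L_def)
    have LC: "0 < L * C + 1" using L0 C0 by (simp add: add_nonneg_pos)
    have \<epsilon>: "0 < \<epsilon>" using e' LC by (simp add: \<epsilon>_def)
    have "\<epsilon> powr p = e' / (L * C + 1)"
      using \<open>1 \<le> p\<close> e' LC by (simp add: \<epsilon>_def powr_powr)
    then have "L * (\<epsilon> powr p * C) = (L * C) * (e' / (L * C + 1))"
      by simp
    also have "\<dots> \<le> (L * C + 1) * (e' / (L * C + 1))"
      using e' LC by (intro mult_right_mono) auto
    also have "\<dots> = e'" using LC by simp
    finally have 2: "ennreal L * ennreal (\<epsilon> powr p * C) \<le> ennreal e'"
      using L0 C0 by (simp add: ennreal_leI flip: ennreal_mult)
    have "(\<lambda>n. ennreal L * J n) \<longlonglongrightarrow> ennreal L * 0"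
      using J by (intro tendsto_mult_ennreal tendsto_const) auto
    then have 1: "\<forall>\<^sub>F n in sequentially. ennreal L * J n < ennreal e'"
      using e' by (intro order_tendstoD) auto
    have 3: "\<forall>\<^sub>F n in sequentially. b \<epsilon> n powr p < e'"
      using b[OF \<epsilon>] e' by (rule order_tendstoD)
    show "\<forall>\<^sub>F n in sequentially. T n \<le> ennreal e"
      using J_fin 1 3
    proof eventually_elim
      case (elim n)
      have "T n \<le> ennreal (4 powr p) * (ennreal L * J n + (ennreal L * ennreal (\<epsilon> powr p * C) + ennreal (b \<epsilon> n powr p)))"
        using elim \<epsilon> by (intro bound) auto
      also have "\<dots> \<le> ennreal (4 powr p) * (ennreal e' + (ennreal e' + ennreal e'))"
        using elim 2 by (intro mult_left_mono add_mono) (auto intro: ennreal_leI)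
      also have "\<dots> = ennreal (4 powr p * (e' + (e' + e')))"
        using less_imp_le[OF e'] by (simp only: ennreal_mult ennreal_plus add_nonneg_nonneg powr_ge_zero)
      also have "4 powr p * (e' + (e' + e')) = e"
        by (simp add: e'_def field_simps)
      finally show ?case .
    qed
  qed
  have "(\<lambda>n. \<P>(\<omega> in M. norm (centered_integral M (\<nu> n) (X n) \<omega>) > \<epsilon>)) \<longlonglongrightarrow> 0" if \<epsilon>: "0 < \<epsilon>" for \<epsilon>
  proof -
    let ?B = "\<lambda>n. {\<omega>\<in>space M. norm (centered_integral M (\<nu> n) (X n) \<omega>) > \<epsilon>}"
    have lim: "(\<lambda>n. ennreal (1 / \<epsilon> powr p) * T n) \<longlonglongrightarrow> 0"
      using tendsto_mult_ennreal[OF tendsto_const T, of "ennreal (1 / \<epsilon> powr p)"] by simp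
    have "\<forall>\<^sub>F n in sequentially. emeasure M (?B n) \<le> ennreal (1 / \<epsilon> powr p) * T n"
      using eventually_ge_at_top[of 1]
    proof eventually_elim
      case (elim n)
      interpret prob_finite_pair M "\<nu> n" using elim by (rule pair)
      have [measurable]: "centered_integral M (\<nu> n) (X n) \<in> borel_measurable M"
        using elim by (intro borel_measurable_centered_integral X_meas)
      \<comment> \<open>Prepares Markov's inequality for the p-th power of the norm, scaled so that
        the threshold becomes 1.\<close>
      have "emeasure M (?B n) \<le> emeasure M {\<omega>\<in>space M. 1 \<le> ennreal (1 / \<epsilon> powr p) *
          ennreal (norm (centered_integral M (\<nu> n) (X n) \<omega>) powr p)}"
      proof (intro emeasure_mono subsetI)
        fix \<omega> assume "\<omega> \<in> ?B n"
        then have "\<epsilon> powr p \<le> norm (centered_integral M (\<nu> n) (X n) \<omega>) powr p" "\<omega> \<in> space M"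
          using \<epsilon> \<open>1 \<le> p\<close> by (auto intro!: powr_mono2)
        then show "\<omega> \<in> {\<omega>\<in>space M. 1 \<le> ennreal (1 / \<epsilon> powr p) *
          ennreal (norm (centered_integral M (\<nu> n) (X n) \<omega>) powr p)}"
          using \<epsilon> by (simp add: field_simps flip: ennreal_mult ennreal_1)
      qed measurable
      also have "\<dots> \<le> ennreal (1 / \<epsilon> powr p) *
          (\<integral>\<^sup>+\<omega>. ennreal (norm (centered_integral M (\<nu> n) (X n) \<omega>) powr p) * indicator (space M) \<omega> \<partial>M)"
        by (intro nn_integral_Markov_inequality) auto
      also have "\<dots> = ennreal (1 / \<epsilon> powr p) * T n"
        unfolding T_def by (intro arg_cong2[where f = "(*)"] refl nn_integral_cong) simp
      finally show ?case .
    qed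
    then have "(\<lambda>n. emeasure M (?B n)) \<longlonglongrightarrow> 0"
      by (intro tendsto_sandwich[OF _ _ tendsto_const lim]) auto
    then show ?thesis
      by (simp add: M.emeasure_eq_measure ennreal_tendsto_0_iff)
  qed
  then show ?thesis
    using J_fin integrable T by (auto simp: T_def[abs_def] elim: eventually_mono)
qed

end
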